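(* Let $R$ be a commutative ring with $1\neq0$, let $S$ be a multiplicative set of $R$, let $M$ be an $R$-module, and let $N$ be a submodule of $M$. Let $R\propto M$ be the trivial extension of $R$ by $M$. Then $S\propto N=\{(s,n): s\in S,\ n\in N\}$ is a strongly multiplicative set of $R\propto M$ if and only if $S$ is a strongly multiplicative set of $R$.
   Context: A multiplicative set $S$ of a commutative ring $R$ is a subset with $0\notin S$, $1\in S$, and $st\in S$ for all $s,t\in S$. It is strongly multiplicative if $\bigl(\bigcap_{i\in\Delta}s_iR\bigr)\cap S\neq\varnothing$ for every family $(s_i)_{i\in\Delta}$ of elements of $S$. The trivial extension $R\propto M$ is the ring $R\oplus M$ with componentwise addition and multiplication $(r,m)(r',m')=(rr',rm'+r'm)$. *)

theory Defs
  imports "HOL-Algebra.Ideal" "HOL-Algebra.Module"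
begin

definition multiplicative_set :: "('a, 'r) ring_scheme \<Rightarrow> 'a set \<Rightarrow> bool"
  where "multiplicative_set R S \<longleftrightarrow> submonoid S R \<and> \<zero>\<^bsub>R\<^esub> \<notin> S"

text \<open>
  A definition cannot quantify over the type of the index set \<open>\<Delta>\<close>. Since the condition depends
  only on the set of members of the family, and these lie in \<open>S\<close>, index sets over the element
  type suffice; see \<open>strongly_multiplicative_family\<close> below for arbitrary index types.
\<close>

definition strongly_multiplicative :: "('a, 'r) ring_scheme \<Rightarrow> 'a set \<Rightarrow> bool"
  where "strongly_multiplicative R S \<longleftrightarrow>
    multiplicative_set R S \<and>
    (\<forall>(\<Delta> :: 'a set) (s :: 'a \<Rightarrow> 'a).
      (\<forall>i\<in>\<Delta>. s i \<in> S) \<longrightarrow> (\<Inter>i\<in>\<Delta>. PIdl\<^bsub>R\<^esub> (s i)) \<inter> S \<noteq> {})"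

lemma strongly_multiplicative_family:
  fixes \<Delta> :: "'i set" and s :: "'i \<Rightarrow> 'a"
  assumes "strongly_multiplicative R S" and "\<forall>i\<in>\<Delta>. s i \<in> S"
  shows "(\<Inter>i\<in>\<Delta>. PIdl\<^bsub>R\<^esub> (s i)) \<inter> S \<noteq> {}"
proof -
  have "\<forall>x\<in>s ` \<Delta>. id x \<in> S" using assms(2) by auto
  then have "(\<Inter>x\<in>s ` \<Delta>. PIdl\<^bsub>R\<^esub> (id x)) \<inter> S \<noteq> {}"
    using assms(1) unfolding strongly_multiplicative_def by blast
  then show ?thesis by simp
qed

definition trivial_extension ::
    "('a, 'r) ring_scheme \<Rightarrow> ('a, 'm, 'q) module_scheme \<Rightarrow> ('a \<times> 'm) ring"  (infixl \<open>\<propto>\<close> 80)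
  where "R \<propto> M =
    \<lparr>carrier = carrier R \<times> carrier M,
     monoid.mult = (\<lambda>(r, m) (r', m'). (r \<otimes>\<^bsub>R\<^esub> r', r \<odot>\<^bsub>M\<^esub> m' \<oplus>\<^bsub>M\<^esub> r' \<odot>\<^bsub>M\<^esub> m)),
     one = (\<one>\<^bsub>R\<^esub>, \<zero>\<^bsub>M\<^esub>),
     zero = (\<zero>\<^bsub>R\<^esub>, \<zero>\<^bsub>M\<^esub>),
     add = (\<lambda>(r, m) (r', m'). (r \<oplus>\<^bsub>R\<^esub> r', m \<oplus>\<^bsub>M\<^esub> m'))\<rparr>"

lemma (in module) trivial_extension_cring: "cring (R \<propto> M)"
proof (rule cringI)
  show "abelian_group (R \<propto> M)"
  proof (rule abelian_groupI)
    fix x assume "x \<in> carrier (R \<propto> M)"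
    then show "\<exists>y\<in>carrier (R \<propto> M). y \<oplus>\<^bsub>R \<propto> M\<^esub> x = \<zero>\<^bsub>R \<propto> M\<^esub>"
      by (intro bexI[of _ "(\<ominus> fst x, \<ominus>\<^bsub>M\<^esub> snd x)"])
        (auto simp: trivial_extension_def R.l_neg M.l_neg)
  qed (auto simp: trivial_extension_def R.a_ac M.a_ac)
  show "comm_monoid (R \<propto> M)"
  proof (rule comm_monoidI)
    fix x y z assume "x \<in> carrier (R \<propto> M)" "y \<in> carrier (R \<propto> M)" "z \<in> carrier (R \<propto> M)"
    then show "x \<otimes>\<^bsub>R \<propto> M\<^esub> y \<otimes>\<^bsub>R \<propto> M\<^esub> z = x \<otimes>\<^bsub>R \<propto> M\<^esub> (y \<otimes>\<^bsub>R \<propto> M\<^esub> z)"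
      by (auto simp: trivial_extension_def R.m_ac M.a_ac smult_r_distr smult_assoc1[symmetric])
  qed (auto simp: trivial_extension_def R.m_ac M.a_ac)
  fix x y z assume "x \<in> carrier (R \<propto> M)" "y \<in> carrier (R \<propto> M)" "z \<in> carrier (R \<propto> M)"
  then show "(x \<oplus>\<^bsub>R \<propto> M\<^esub> y) \<otimes>\<^bsub>R \<propto> M\<^esub> z = x \<otimes>\<^bsub>R \<propto> M\<^esub> z \<oplus>\<^bsub>R \<propto> M\<^esub> y \<otimes>\<^bsub>R \<propto> M\<^esub> z"
    by (auto simp: trivial_extension_def R.l_distr M.a_ac smult_l_distr smult_r_distr)
qed

end

theory Submission
  imports Defs
begin

text \<open>
  Taking the family of all elements of \<open>S\<close>, strong multiplicativity asks for a common
  multiple \<open>t \<in> S\<close> of \<open>S\<close>. If \<open>t = r s\<close>, then \<open>(r\<^sup>2 s, - r\<^sup>2 n) (s, n) = (t\<^sup>2, 0)\<close>, so that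
  \<open>(t\<^sup>2, 0)\<close> is a common multiple of \<open>S \<propto> N\<close>. Conversely, the first component of
  a common multiple of \<open>S \<propto> N\<close> is a common multiple of \<open>S\<close>.
\<close>

text \<open>This trades the quantifier over families for a single witness: one \<open>t\<close> lies
  in the intersection for every family at once, also for the empty one, whose intersection is
  \<open>UNIV\<close>.\<close>

lemma strongly_multiplicative_iff_common_multiple:
  fixes R :: "('a, 'r) ring_scheme"
  shows "strongly_multiplicative R S \<longleftrightarrow>
    multiplicative_set R S \<and> (\<exists>t\<in>S. \<forall>s\<in>S. t \<in> PIdl\<^bsub>R\<^esub> s)"
proof
  assume L: "strongly_multiplicative R S"
  have "(\<Inter>s\<in>S. PIdl\<^bsub>R\<^esub> s) \<inter> S \<noteq> {}"
    using strongly_multiplicative_family[OF L, of S "\<lambda>s. s"] by simp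
  then have "\<exists>t\<in>S. \<forall>s\<in>S. t \<in> PIdl\<^bsub>R\<^esub> s" by blast
  moreover have "multiplicative_set R S"
    using L by (simp only: strongly_multiplicative_def)
  ultimately show "multiplicative_set R S \<and> (\<exists>t\<in>S. \<forall>s\<in>S. t \<in> PIdl\<^bsub>R\<^esub> s)" by simp
next
  assume A: "multiplicative_set R S \<and> (\<exists>t\<in>S. \<forall>s\<in>S. t \<in> PIdl\<^bsub>R\<^esub> s)"
  then obtain t where t: "t \<in> S" "\<And>s. s \<in> S \<Longrightarrow> t \<in> PIdl\<^bsub>R\<^esub> s" by blast
  show "strongly_multiplicative R S"
    unfolding strongly_multiplicative_def
  proof (intro conjI allI impI)
    show "multiplicative_set R S" using A by simp
    fix \<Delta> :: "'a set" and s :: "'a \<Rightarrow> 'a"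
    assume "\<forall>i\<in>\<Delta>. s i \<in> S"
    then have "t \<in> (\<Inter>i\<in>\<Delta>. PIdl\<^bsub>R\<^esub> (s i)) \<inter> S" using t by simp
    then show "(\<Inter>i\<in>\<Delta>. PIdl\<^bsub>R\<^esub> (s i)) \<inter> S \<noteq> {}" by (metis empty_iff)
  qed
qed

text \<open>The second component of a product, \<open>s n' + s' n\<close>, stays in \<open>N\<close>
  because \<open>N\<close> is a submodule, and the zero of \<open>R \<propto> M\<close> has first
  component zero, which is not in \<open>S\<close>.\<close>

lemma (in module) multiplicative_set_trivial_extension:
  assumes S: "multiplicative_set R S" and N: "submodule N R M"
  shows "multiplicative_set (R \<propto> M) (S \<times> N)"
proof -
  interpret S: submonoid S R
    using S by (simp add: multiplicative_set_def)
  interpret N: submodule N R M by (rule N)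
  \<comment> \<open>A submodule is a subgroup of the additive monoid of \<open>M\<close>, so
    \<open>one_closed\<close> concerns zero and \<open>m_closed\<close> addition.\<close>
  have N0: "\<zero>\<^bsub>M\<^esub> \<in> N" using N.one_closed by simp
  have Na: "\<And>x y. x \<in> N \<Longrightarrow> y \<in> N \<Longrightarrow> x \<oplus>\<^bsub>M\<^esub> y \<in> N" using N.m_closed by simp
  have "S \<subseteq> carrier R" "N \<subseteq> carrier M" using S.subset N.subset by auto
  then have "submonoid (S \<times> N) (R \<propto> M)"
    by (intro submonoid.intro)
      (auto simp: trivial_extension_def N0 intro!: Na N.smult_closed)
  then show ?thesis
    using S by (auto simp: multiplicative_set_def trivial_extension_def)
qed

theorem theorem2p19:
  fixes R :: "('a, 'r) ring_scheme"
    and M :: "('a, 'm, 'q) module_scheme"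
    and S :: "'a set"
    and N :: "'m set"
  assumes "cring R"
    and "\<one>\<^bsub>R\<^esub> \<noteq> \<zero>\<^bsub>R\<^esub>"
    and "multiplicative_set R S"
    and "module R M"
    and "submodule N R M"
  shows "strongly_multiplicative (R \<propto> M) (S \<times> N) \<longleftrightarrow> strongly_multiplicative R S"
proof -
  interpret module R M by (rule assms(4))
  interpret S: submonoid S R
    using assms(3) by (simp add: multiplicative_set_def)
  interpret N: submodule N R M by (rule assms(5))
  have N0: "\<zero>\<^bsub>M\<^esub> \<in> N" using N.one_closed by simp
  have SR: "S \<subseteq> carrier R" and NM: "N \<subseteq> carrier M" using S.subset N.subset by auto
  \<comment> \<open>Both sets are multiplicative, so only the existence of common multiples is left
    to compare.\<close>
  have "(\<exists>t\<in>S \<times> N. \<forall>s\<in>S \<times> N. t \<in> PIdl\<^bsub>R \<propto> M\<^esub> s) \<longleftrightarrow> (\<exists>t\<in>S. \<forall>s\<in>S. t \<in> PIdl\<^bsub>R\<^esub> s)"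
  proof
    assume "\<exists>t\<in>S \<times> N. \<forall>s\<in>S \<times> N. t \<in> PIdl\<^bsub>R \<propto> M\<^esub> s"
    then obtain t n where t: "t \<in> S"
      and tn: "\<And>s. s \<in> S \<Longrightarrow> (t, n) \<in> PIdl\<^bsub>R \<propto> M\<^esub> (s, \<zero>\<^bsub>M\<^esub>)"
      using N0 by fastforce
    \<comment> \<open>The first component of \<open>(r, m) (s, 0)\<close> is
      \<open>r s\<close>.\<close>
    have "t \<in> PIdl\<^bsub>R\<^esub> s" if "s \<in> S" for s
      using tn[OF that] by (auto simp: cgenideal_def trivial_extension_def)
    with t show "\<exists>t\<in>S. \<forall>s\<in>S. t \<in> PIdl\<^bsub>R\<^esub> s" by blast
  next
    assume "\<exists>t\<in>S. \<forall>s\<in>S. t \<in> PIdl\<^bsub>R\<^esub> s"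
    then obtain t where t: "t \<in> S" and ts: "\<And>s. s \<in> S \<Longrightarrow> t \<in> PIdl\<^bsub>R\<^esub> s" by blast
    \<comment> \<open>The square is taken because \<open>(t, 0)\<close> with multiplier
      \<open>(r, m)\<close> would need \<open>s m = - r n\<close>, which may have no solution
      \<open>m\<close>. The multiplier \<open>r\<^sup>2 s\<close> instead leaves
      \<open>s m = - r\<^sup>2 s n\<close>, solved by \<open>m = - r\<^sup>2 n\<close>.\<close>
    have "(t \<otimes>\<^bsub>R\<^esub> t, \<zero>\<^bsub>M\<^esub>) \<in> PIdl\<^bsub>R \<propto> M\<^esub> (s, n)" if s: "s \<in> S" and n: "n \<in> N" for s n
    proof -
      have sR: "s \<in> carrier R" and nM: "n \<in> carrier M" using s n SR NM by auto
      obtain r where r: "r \<in> carrier R" and tr: "t = r \<otimes>\<^bsub>R\<^esub> s"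
        using ts[OF s] by (auto simp: cgenideal_def)
      let ?q = "r \<otimes>\<^bsub>R\<^esub> r"
      let ?x = "(?q \<otimes>\<^bsub>R\<^esub> s, \<ominus>\<^bsub>M\<^esub> (?q \<odot>\<^bsub>M\<^esub> n))"
      have "s \<odot>\<^bsub>M\<^esub> (\<ominus>\<^bsub>M\<^esub> (?q \<odot>\<^bsub>M\<^esub> n)) = \<ominus>\<^bsub>M\<^esub> ((?q \<otimes>\<^bsub>R\<^esub> s) \<odot>\<^bsub>M\<^esub> n)"
        using sR nM r by (simp add: smult_r_minus smult_assoc1[symmetric] R.m_comm)
      then have "(t \<otimes>\<^bsub>R\<^esub> t, \<zero>\<^bsub>M\<^esub>) = ?x \<otimes>\<^bsub>R \<propto> M\<^esub> (s, n)"
        using sR nM r by (simp add: trivial_extension_def tr M.r_neg R.m_ac)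
      moreover have "?x \<in> carrier (R \<propto> M)"
        using sR nM r by (simp add: trivial_extension_def)
      ultimately show ?thesis unfolding cgenideal_def by blast
    qed
    then show "\<exists>t\<in>S \<times> N. \<forall>s\<in>S \<times> N. t \<in> PIdl\<^bsub>R \<propto> M\<^esub> s"
      using t N0 S.m_closed by (intro bexI[of _ "(t \<otimes>\<^bsub>R\<^esub> t, \<zero>\<^bsub>M\<^esub>)"]) auto
  qed
  with assms(3) multiplicative_set_trivial_extension[OF assms(3,5)] show ?thesis
    by (simp add: strongly_multiplicative_iff_common_multiple)
qed

end
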